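(* Let $\Omega$ be a connected weighted simplicial complex on $[n]$ with a free action of the finite group $G$, and let $\mathcal C^{[i]}\subseteq\mathbb R[\mathbf x^{[i]}]$ ($i\in[n]$) be convex cones with $\mathcal C^{[i]}=\mathcal C^{[gi]}$ for all $g\in G$, $i\in[n]$ (identifying $\mathbf x^{[i]}$ with $\mathbf x^{[gi]}$). Then every $G$-invariant $p\in\mathcal C_{\mathrm{sep}}$ admits a separable $(\Omega,G)$-decomposition.
   Context: $[n]=\{0,\dots,n\}$ and $\mathbb N=\{0,1,2,\dots\}$. A weighted simplicial complex on $[n]$ is a map $\Omega$ from the power set of $[n]$ to $\mathbb N$ such that $\Omega(S_1)$ divides $\Omega(S_2)$ whenever $S_1\subseteq S_2$; it is always assumed that $\Omega(\{i\})\neq 0$ for all $i\in[n]$. Sets $S$ with $\Omega(S)\ne0$ are called simplices, inclusion-maximal simplices are called facets, and $\mathcal F$ is the set of facets. $\widetilde{\mathcal F}$ is the multiset containing each facet $F$ exactly $\Omega(F)$ times (copies are regarded as distinct elements), $c:\widetilde{\mathcal F}\to\mathcal F$ maps each copy to its underlying facet, and $\widetilde{\mathcal F}_i=\{\mathfrak f\in\widetilde{\mathcal F}: i\in c(\mathfrak f)\}$. Two vertices are neighbours if some facet contains both; $\Omega$ is connected if any two vertices are joined by a chain of consecutive neighbours. An action of a finite group $G$ on $\Omega$ consists of an action of $G$ on $[n]$ with $\Omega(gS)=\Omega(S)$ for all $g\in G$, $S\subseteq[n]$, together with an action of $G$ on the set $\widetilde{\mathcal F}$ such that $c(g\mathfrak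 f)=g\,c(\mathfrak f)$. The action on $\Omega$ is called free if the action on $\widetilde{\mathcal F}$ is free (all stabilizers are trivial). For each $i\in[n]$, $\mathbf x^{[i]}=(x^{[i]}_1,\dots,x^{[i]}_{m_i})$ is a collection of variables, with $m_i=m_{gi}$ for all $g\in G$; $\mathcal P=\mathbb R[\mathbf x^{[0]},\dots,\mathbf x^{[n]}]$. If $m_i=m_j$ and $f\in\mathbb R[\mathbf x^{[i]}]$, then $f(\mathbf x^{[j]})$ denotes the polynomial obtained by substituting $\mathbf x^{[j]}$ for $\mathbf x^{[i]}$. $G$ acts on $\mathcal P$ by $(gp)(\mathbf x^{[0]},\dots,\mathbf x^{[n]})=p(\mathbf x^{[g0]},\dots,\mathbf x^{[gn]})$, and $p$ is $G$-invariant if $gp=p$ for all $g\in G$. A convex cone is a nonempty set $\mathcal C$ with $\lambda p+\mu q\in\mathcal C$ for all $p,q\in\mathcal C$ and real $\lambda,\mu\ge0$. The separable cone is $$\mathcal C_{\mathrm{sep}}=\Big\{\sum_{j=1}^r p_j^{[0]}\cdots p_j^{[n]}: r\in\mathbb N,\ p_j^{[i]}\in\mathcal C^{[i]}\Big\}\subseteq\mathcal P.$$ For sets $A,\mathcal I$, $\mathcal I^A$ denotes the set of functions $A\to\mathcal I$. For $\alpha\in\mathcal I^{\widetilde{\mathcal F}}$, $\alpha_{|_i}$ is its restriction to $\widetilde{\mathcal F}_i$. For $\beta\in\mathcal I^{\widetilde{\mathcal F}_i}$ and $g\in G$, ${}^g\beta\in\mathcal I^{\widetilde{\mathcal F}_{gi}}$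 is defined by $({}^g\beta)(\mathfrak f)=\beta(g^{-1}\mathfrak f)$. A separable $(\Omega,G)$-decomposition of $p$ consists of a finite index set $\mathcal I$ and local polynomials $p^{[i]}_\beta\in\mathcal C^{[i]}$ for $i\in[n]$, $\beta\in\mathcal I^{\widetilde{\mathcal F}_i}$, such that $$p=\sum_{\alpha\in\mathcal I^{\widetilde{\mathcal F}}}p^{[0]}_{\alpha_{|_0}}(\mathbf x^{[0]})\cdots p^{[n]}_{\alpha_{|_n}}(\mathbf x^{[n]})$$ and $p^{[i]}_\beta(\mathbf x^{[i]})=p^{[gi]}_{{}^g\beta}(\mathbf x^{[i]})$ for all $i\in[n]$, $g\in G$, $\beta\in\mathcal I^{\widetilde{\mathcal F}_i}$. *)

theory Defs
  imports Complex_Main "HOL-Library.Poly_Mapping" "HOL-Library.FuncSet" "HOL-Algebra.Group_Action"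
begin

text \<open>
  Real polynomials in variables indexed by pairs \<open>(i, k)\<close>, the pair \<open>(i, k)\<close> standing for the
  variable \<open>x\<^sup>[\<^sup>i\<^sup>]\<^sub>k\<close>. A polynomial is a finitely supported map from monomials to coefficients,
  a monomial a finitely supported map from variables to exponents; the commutative ring
  structure is the convolution product of \<^theory>\<open>HOL-Library.Poly_Mapping\<close>.
\<close>

type_synonym rpoly = "((nat \<times> nat) \<Rightarrow>\<^sub>0 nat) \<Rightarrow>\<^sub>0 real"

definition pconst :: "real \<Rightarrow> rpoly" where
  "pconst c = Poly_Mapping.single 0 c"

definition pvar :: "nat \<times> nat \<Rightarrow> rpoly" where
  "pvar v = Poly_Mapping.single (Poly_Mapping.single v 1) 1"

definition pvars :: "rpoly \<Rightarrow> (nat \<times> nat) set" where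
  "pvars p = (\<Union>t \<in> Poly_Mapping.keys p. Poly_Mapping.keys t)"

definition psubst :: "(nat \<times> nat \<Rightarrow> rpoly) \<Rightarrow> rpoly \<Rightarrow> rpoly" where
  "psubst \<sigma> p =
     (\<Sum>t \<in> Poly_Mapping.keys p.
        pconst (Poly_Mapping.lookup p t) *
        (\<Prod>v \<in> Poly_Mapping.keys t. \<sigma> v ^ Poly_Mapping.lookup t v))"

text \<open>The subring \<open>\<real>[x\<^sup>[\<^sup>i\<^sup>]]\<close>, where the block \<open>x\<^sup>[\<^sup>i\<^sup>]\<close> consists of \<open>m i\<close> variables.\<close>

definition local_ring :: "(nat \<Rightarrow> nat) \<Rightarrow> nat \<Rightarrow> rpoly set" where
  "local_ring m i = {p. pvars p \<subseteq> {i} \<times> {1..m i}}"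

text \<open>\<open>block_subst i j f\<close> is \<open>f(x\<^sup>[\<^sup>j\<^sup>])\<close> for \<open>f\<close> in \<open>\<real>[x\<^sup>[\<^sup>i\<^sup>]]\<close>.\<close>

definition block_subst :: "nat \<Rightarrow> nat \<Rightarrow> rpoly \<Rightarrow> rpoly" where
  "block_subst i j = psubst (\<lambda>(l, k). pvar (if l = i then j else l, k))"

definition poly_act :: "('g \<Rightarrow> nat \<Rightarrow> nat) \<Rightarrow> 'g \<Rightarrow> rpoly \<Rightarrow> rpoly" where
  "poly_act \<phi> g = psubst (\<lambda>(i, k). pvar (\<phi> g i, k))"

definition poly_invariant ::
  "('g, 'b) monoid_scheme \<Rightarrow> ('g \<Rightarrow> nat \<Rightarrow> nat) \<Rightarrow> rpoly \<Rightarrow> bool" where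
  "poly_invariant G \<phi> p \<longleftrightarrow> (\<forall>g \<in> carrier G. poly_act \<phi> g p = p)"

definition convex_poly_cone :: "rpoly set \<Rightarrow> bool" where
  "convex_poly_cone C \<longleftrightarrow>
     C \<noteq> {} \<and>
     (\<forall>p \<in> C. \<forall>q \<in> C. \<forall>a b. 0 \<le> a \<longrightarrow> 0 \<le> b \<longrightarrow> pconst a * p + pconst b * q \<in> C)"

definition sep_cone :: "nat \<Rightarrow> (nat \<Rightarrow> rpoly set) \<Rightarrow> rpoly set" where
  "sep_cone n C =
     {(\<Sum>j<r. \<Prod>i\<in>{0..n}. q j i) | (r :: nat) (q :: nat \<Rightarrow> nat \<Rightarrow> rpoly).
        \<forall>j<r. \<forall>i\<in>{0..n}. q j i \<in> C i}"

text \<open>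
  A weighted simplicial complex on \<open>{0..n}\<close>; only the values of \<open>\<Omega>\<close> on subsets of \<open>{0..n}\<close>
  are relevant.
\<close>

definition weighted_complex :: "nat \<Rightarrow> (nat set \<Rightarrow> nat) \<Rightarrow> bool" where
  "weighted_complex n \<Omega> \<longleftrightarrow>
     (\<forall>S T. S \<subseteq> T \<longrightarrow> T \<subseteq> {0..n} \<longrightarrow> \<Omega> S dvd \<Omega> T) \<and> (\<forall>i\<in>{0..n}. \<Omega> {i} \<noteq> 0)"

definition simplices :: "nat \<Rightarrow> (nat set \<Rightarrow> nat) \<Rightarrow> nat set set" where
  "simplices n \<Omega> = {S. S \<subseteq> {0..n} \<and> \<Omega> S \<noteq> 0}"

definition facets :: "nat \<Rightarrow> (nat set \<Rightarrow> nat) \<Rightarrow> nat set set" where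
  "facets n \<Omega> = {F \<in> simplices n \<Omega>. \<forall>S \<in> simplices n \<Omega>. F \<subseteq> S \<longrightarrow> S = F}"

text \<open>
  The multiset of facets, whose elements are to be told apart, is the set of pairs \<open>(F, k)\<close>
  with \<open>k < \<Omega> F\<close>; the collapse map \<open>c\<close> is \<^const>\<open>fst\<close>.
\<close>

definition facet_copies :: "nat \<Rightarrow> (nat set \<Rightarrow> nat) \<Rightarrow> (nat set \<times> nat) set" where
  "facet_copies n \<Omega> = {(F, k). F \<in> facets n \<Omega> \<and> k < \<Omega> F}"

definition facet_copies_at :: "nat \<Rightarrow> (nat set \<Rightarrow> nat) \<Rightarrow> nat \<Rightarrow> (nat set \<times> nat) set" where
  "facet_copies_at n \<Omega> i = {f \<in> facet_copies n \<Omega>. i \<in> fst f}"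

definition neighbours :: "nat \<Rightarrow> (nat set \<Rightarrow> nat) \<Rightarrow> (nat \<times> nat) set" where
  "neighbours n \<Omega> = {(i, j). \<exists>F \<in> facets n \<Omega>. i \<in> F \<and> j \<in> F}"

definition connected_complex :: "nat \<Rightarrow> (nat set \<Rightarrow> nat) \<Rightarrow> bool" where
  "connected_complex n \<Omega> \<longleftrightarrow> (\<forall>i\<in>{0..n}. \<forall>j\<in>{0..n}. (i, j) \<in> (neighbours n \<Omega>)\<^sup>*)"

definition complex_action ::
  "nat \<Rightarrow> (nat set \<Rightarrow> nat) \<Rightarrow> ('g, 'b) monoid_scheme \<Rightarrow> ('g \<Rightarrow> nat \<Rightarrow> nat) \<Rightarrow>
   ('g \<Rightarrow> nat set \<times> nat \<Rightarrow> nat set \<times> nat) \<Rightarrow> bool" where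
  "complex_action n \<Omega> G \<phi> \<psi> \<longleftrightarrow>
     group_action G {0..n} \<phi> \<and>
     (\<forall>g \<in> carrier G. \<forall>S. S \<subseteq> {0..n} \<longrightarrow> \<Omega> (\<phi> g ` S) = \<Omega> S) \<and>
     group_action G (facet_copies n \<Omega>) \<psi> \<and>
     (\<forall>g \<in> carrier G. \<forall>f \<in> facet_copies n \<Omega>. fst (\<psi> g f) = \<phi> g ` fst f)"

definition free_complex_action ::
  "nat \<Rightarrow> (nat set \<Rightarrow> nat) \<Rightarrow> ('g, 'b) monoid_scheme \<Rightarrow> ('g \<Rightarrow> nat \<Rightarrow> nat) \<Rightarrow>
   ('g \<Rightarrow> nat set \<times> nat \<Rightarrow> nat set \<times> nat) \<Rightarrow> bool" where
  "free_complex_action n \<Omega> G \<phi> \<psi> \<longleftrightarrow>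
     complex_action n \<Omega> G \<phi> \<psi> \<and>
     (\<forall>f \<in> facet_copies n \<Omega>. stabilizer G \<psi> f = {\<one>\<^bsub>G\<^esub>})"

text \<open>For \<open>\<beta>\<close> on the facet copies at \<open>i\<close>, the function \<open>\<^sup>g\<beta>\<close> on the facet copies at \<open>g i\<close>.\<close>

definition index_act ::
  "nat \<Rightarrow> (nat set \<Rightarrow> nat) \<Rightarrow> ('g, 'b) monoid_scheme \<Rightarrow> ('g \<Rightarrow> nat \<Rightarrow> nat) \<Rightarrow>
   ('g \<Rightarrow> nat set \<times> nat \<Rightarrow> nat set \<times> nat) \<Rightarrow> nat \<Rightarrow> 'g \<Rightarrow>
   (nat set \<times> nat \<Rightarrow> 'i) \<Rightarrow> nat set \<times> nat \<Rightarrow> 'i" where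
  "index_act n \<Omega> G \<phi> \<psi> i g \<beta> =
     (\<lambda>f \<in> facet_copies_at n \<Omega> (\<phi> g i). \<beta> (\<psi> (inv\<^bsub>G\<^esub> g) f))"

text \<open>
  Functions between sets are extensional, so that \<open>A \<rightarrow>\<^sub>E I\<close> is the set of functions from \<open>A\<close>
  to \<open>I\<close> and the sum over index functions has one term for each of them.
\<close>

definition separable_decomposition ::
  "nat \<Rightarrow> (nat set \<Rightarrow> nat) \<Rightarrow> ('g, 'b) monoid_scheme \<Rightarrow> ('g \<Rightarrow> nat \<Rightarrow> nat) \<Rightarrow>
   ('g \<Rightarrow> nat set \<times> nat \<Rightarrow> nat set \<times> nat) \<Rightarrow> (nat \<Rightarrow> rpoly set) \<Rightarrow> rpoly \<Rightarrow>
   'i set \<Rightarrow> (nat \<Rightarrow> (nat set \<times> nat \<Rightarrow> 'i) \<Rightarrow> rpoly) \<Rightarrow> bool" where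
  "separable_decomposition n \<Omega> G \<phi> \<psi> C p I P \<longleftrightarrow>
     finite I \<and>
     (\<forall>i\<in>{0..n}. \<forall>\<beta> \<in> facet_copies_at n \<Omega> i \<rightarrow>\<^sub>E I. P i \<beta> \<in> C i) \<and>
     p = (\<Sum>\<alpha> \<in> facet_copies n \<Omega> \<rightarrow>\<^sub>E I.
            \<Prod>i\<in>{0..n}. P i (restrict \<alpha> (facet_copies_at n \<Omega> i))) \<and>
     (\<forall>i\<in>{0..n}. \<forall>g \<in> carrier G. \<forall>\<beta> \<in> facet_copies_at n \<Omega> i \<rightarrow>\<^sub>E I.
        P i \<beta> = block_subst (\<phi> g i) i (P (\<phi> g i) (index_act n \<Omega> G \<phi> \<psi> i g \<beta>)))"

text \<open>
  Every finite set is in bijection with a finite set of natural numbers, so taking the index set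
  among the latter loses no decomposition.
\<close>

definition admits_separable_decomposition ::
  "nat \<Rightarrow> (nat set \<Rightarrow> nat) \<Rightarrow> ('g, 'b) monoid_scheme \<Rightarrow> ('g \<Rightarrow> nat \<Rightarrow> nat) \<Rightarrow>
   ('g \<Rightarrow> nat set \<times> nat \<Rightarrow> nat set \<times> nat) \<Rightarrow> (nat \<Rightarrow> rpoly set) \<Rightarrow> rpoly \<Rightarrow> bool" where
  "admits_separable_decomposition n \<Omega> G \<phi> \<psi> C p \<longleftrightarrow>
     (\<exists>(I :: nat set) P. separable_decomposition n \<Omega> G \<phi> \<psi> C p I P)"

end

theory Submission
  imports Defs
begin

text \<open>
  Write \<open>p = \<Sum>j<r. p\<^sub>j\<close> with \<open>p\<^sub>j = \<Prod>i. q j i\<close>. By invariance, \<open>p\<close> is the average of the translates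
  \<open>h p\<^sub>j\<close> over all labels \<open>(j, h)\<close>. Freeness yields an equivariant map \<open>z\<close> from the facet copies
  to \<open>G\<close>, and an index \<open>(j, a)\<close> placed at the copy \<open>f\<close> is read as the label \<open>(j, z f \<otimes> a)\<close>.
  The local polynomial at \<open>i\<close> is the \<open>i\<close>-th factor of \<open>h p\<^sub>j\<close> if all copies at \<open>i\<close> show the same
  label \<open>(j, h)\<close>, and \<open>0\<close> otherwise. By connectedness only the assignments showing one label
  everywhere contribute to the sum, and since reading labels through \<open>z\<close> turns the action on
  indices into left multiplication on the component \<open>h\<close>, the local polynomials are equivariant.
\<close>

section \<open>Substitution in polynomials\<close>

abbreviation monom_subst :: "(nat \<times> nat \<Rightarrow> rpoly) \<Rightarrow> (nat \<times> nat \<Rightarrow>\<^sub>0 nat) \<Rightarrow> rpoly" where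
  "monom_subst \<sigma> t \<equiv> \<Prod>v \<in> Poly_Mapping.keys t. \<sigma> v ^ Poly_Mapping.lookup t v"

lemma pconst_0 [simp]: "pconst 0 = 0"
  by (simp add: pconst_def)

lemma pconst_1 [simp]: "pconst 1 = 1"
  by (simp add: pconst_def)

lemma pconst_add: "pconst (a + b) = pconst a + pconst b"
  by (simp add: pconst_def single_add)

lemma pconst_mult: "pconst (a * b) = pconst a * pconst b"
  by (simp add: pconst_def mult_single)

lemma pconst_power: "pconst (a ^ k) = pconst a ^ k"
  by (induction k) (simp_all add: pconst_mult)

lemma pconst_of_nat: "pconst (of_nat k) = of_nat k"
  by (simp add: pconst_def)

lemma rpoly_expansion:
  "p = (\<Sum>t \<in> Poly_Mapping.keys p. Poly_Mapping.single t (Poly_Mapping.lookup p t))"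
  by (rule poly_mapping_eqI)
    (simp add: lookup_sum lookup_single when_def in_keys_iff)

text \<open>Terms outside the keys have coefficient 0. Cancellation can make
  \<open>keys (p + q)\<close> smaller than the union of the two key sets, so additivity is checked
  termwise over that common superset.\<close>

lemma psubst_superset:
  assumes "finite A" "Poly_Mapping.keys p \<subseteq> A"
  shows "psubst \<sigma> p = (\<Sum>t \<in> A. pconst (Poly_Mapping.lookup p t) * monom_subst \<sigma> t)"
  unfolding psubst_def using assms
  by (intro sum.mono_neutral_left) (auto simp: in_keys_iff)

lemma monom_subst_superset:
  assumes "finite A" "Poly_Mapping.keys t \<subseteq> A"
  shows "monom_subst \<sigma> t = (\<Prod>v \<in> A. \<sigma> v ^ Poly_Mapping.lookup t v)"
  using assms by (intro prod.mono_neutral_left) (auto simp: in_keys_iff)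

lemma monom_subst_add: "monom_subst \<sigma> (s + t) = monom_subst \<sigma> s * monom_subst \<sigma> t"
proof -
  let ?A = "Poly_Mapping.keys s \<union> Poly_Mapping.keys t"
  have "monom_subst \<sigma> (s + t) = (\<Prod>v \<in> ?A. \<sigma> v ^ Poly_Mapping.lookup (s + t) v)"
    by (rule monom_subst_superset) (simp_all add: keys_add)
  also have "\<dots> = (\<Prod>v \<in> ?A. \<sigma> v ^ Poly_Mapping.lookup s v) * (\<Prod>v \<in> ?A. \<sigma> v ^ Poly_Mapping.lookup t v)"
    by (simp add: lookup_add power_add prod.distrib)
  also have "\<dots> = monom_subst \<sigma> s * monom_subst \<sigma> t"
    by (simp add: monom_subst_superset[of ?A])
  finally show ?thesis .
qed

lemma psubst_0 [simp]: "psubst \<sigma> 0 = 0"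
  by (simp add: psubst_def)

lemma psubst_add: "psubst \<sigma> (p + q) = psubst \<sigma> p + psubst \<sigma> q"
proof -
  let ?A = "Poly_Mapping.keys p \<union> Poly_Mapping.keys q"
  have "psubst \<sigma> (p + q) = (\<Sum>t \<in> ?A. pconst (Poly_Mapping.lookup (p + q) t) * monom_subst \<sigma> t)"
    by (rule psubst_superset) (simp_all add: keys_add)
  also have "\<dots> = psubst \<sigma> p + psubst \<sigma> q"
    by (simp add: psubst_superset[of ?A] lookup_add pconst_add ring_distribs sum.distrib)
  finally show ?thesis .
qed

lemma psubst_sum: "psubst \<sigma> (sum f A) = (\<Sum>x\<in>A. psubst \<sigma> (f x))"
  by (induction A rule: infinite_finite_induct) (simp_all add: psubst_add)

lemma psubst_single: "psubst \<sigma> (Poly_Mapping.single t a) = pconst a * monom_subst \<sigma> t"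
  by (subst psubst_superset[of "{t}"]) auto

text \<open>Expanding both factors into single terms reduces multiplicativity to
  \<open>monom_subst_add\<close> and \<open>pconst_mult\<close>.\<close>

lemma psubst_mult: "psubst \<sigma> (p * q) = psubst \<sigma> p * psubst \<sigma> q"
proof -
  let ?mono = "\<lambda>p t. Poly_Mapping.single t (Poly_Mapping.lookup p t) :: rpoly"
  have "psubst \<sigma> (p * q) = psubst \<sigma> ((\<Sum>s \<in> Poly_Mapping.keys p. ?mono p s) * (\<Sum>t \<in> Poly_Mapping.keys q. ?mono q t))"
    using rpoly_expansion[of p] rpoly_expansion[of q] by simp
  also have "\<dots> = psubst \<sigma> p * psubst \<sigma> q"
    by (simp add: sum_product psubst_sum mult_single psubst_single monom_subst_add pconst_mult
        psubst_def[of _ p] psubst_def[of _ q] mult_ac)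
  finally show ?thesis .
qed

lemma psubst_pconst [simp]: "psubst \<sigma> (pconst c) = pconst c"
  using psubst_single[of \<sigma> 0 c] by (simp add: pconst_def)

lemma psubst_1 [simp]: "psubst \<sigma> 1 = 1"
  using psubst_pconst[of \<sigma> 1] by simp

lemma psubst_prod: "psubst \<sigma> (prod f A) = (\<Prod>x\<in>A. psubst \<sigma> (f x))"
  by (induction A rule: infinite_finite_induct) (simp_all add: psubst_mult)

lemma psubst_power: "psubst \<sigma> (p ^ k) = psubst \<sigma> p ^ k"
  by (induction k) (simp_all add: psubst_mult)

lemma psubst_pvar [simp]: "psubst \<sigma> (pvar v) = \<sigma> v"
  by (simp add: pvar_def psubst_single)

lemma psubst_psubst: "psubst \<sigma> (psubst \<tau> p) = psubst (\<lambda>v. psubst \<sigma> (\<tau> v)) p"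
  by (subst (2) psubst_def)
    (simp add: psubst_sum psubst_mult psubst_prod psubst_power psubst_def[of "\<lambda>v. psubst \<sigma> (\<tau> v)"])

lemma psubst_cong:
  assumes "\<And>v. v \<in> pvars p \<Longrightarrow> \<sigma> v = \<tau> v"
  shows "psubst \<sigma> p = psubst \<tau> p"
proof -
  have "\<sigma> v = \<tau> v" if "t \<in> Poly_Mapping.keys p" "v \<in> Poly_Mapping.keys t" for t v
    using assms that unfolding pvars_def by blast
  then show ?thesis
    unfolding psubst_def by (intro sum.cong prod.cong arg_cong2[where f = "(*)"]) simp_all
qed

text \<open>Locality of \<open>f\<close> matters: a variable of block \<open>l\<close> already
  present in \<open>f\<close> would be carried on to block \<open>i\<close> by the left-hand side
  only.\<close>

lemma block_subst_block_subst:
  assumes "f \<in> local_ring m k"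
  shows "block_subst l i (block_subst k l f) = block_subst k i f"
  unfolding block_subst_def psubst_psubst
  by (rule psubst_cong) (use assms in \<open>auto simp: local_ring_def\<close>)

text \<open>Links the action on all variables with the moves of single blocks that occur in the
  definition of a decomposition.\<close>

lemma poly_act_local:
  assumes "f \<in> local_ring m k"
  shows "poly_act \<phi> g f = block_subst k (\<phi> g k) f"
  unfolding block_subst_def poly_act_def
  by (rule psubst_cong) (use assms in \<open>auto simp: local_ring_def\<close>)

lemma block_subst_pconst_mult:
  "block_subst i j (pconst c * f) = pconst c * block_subst i j f"
  by (simp add: block_subst_def psubst_mult)

section \<open>Convex cones of polynomials\<close>

lemma convex_poly_cone_scale:
  assumes "convex_poly_cone C" "f \<in> C" "0 \<le> c"
  shows "pconst c * f \<in> C"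
proof -
  have "pconst c * f + pconst 0 * f \<in> C"
    using assms unfolding convex_poly_cone_def by blast
  then show ?thesis by simp
qed

text \<open>Needed because local polynomials are set to 0 at inconsistent indices.\<close>

lemma convex_poly_cone_0:
  assumes "convex_poly_cone C"
  shows "0 \<in> C"
proof -
  obtain f where "f \<in> C" using assms unfolding convex_poly_cone_def by blast
  from convex_poly_cone_scale[OF assms this, of 0] show ?thesis by simp
qed

section \<open>Sums over assignments with locally constant labels\<close>

text \<open>Here \<open>V\<close> stands for the vertices, \<open>X\<close> for the facet copies and
  \<open>Xv i\<close> for those at \<open>i\<close>; \<open>L f\<close> reads an index placed at
  \<open>f\<close> as a label. A nonzero product gives each vertex one label, overlaps force
  neighbouring vertices to agree, and connectedness makes the label global. As every
  \<open>L f\<close> is bijective, each label is shown everywhere by exactly one assignment.\<close>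

lemma sum_PiE_constant_labels:
  fixes P :: "'v \<Rightarrow> ('f \<Rightarrow> 'i) \<Rightarrow> 'r::comm_ring_1"
  assumes "finite V" "V \<noteq> {}" "finite X" "finite I"
    and X: "X = (\<Union>i\<in>V. Xv i)" and ne: "\<And>i. i \<in> V \<Longrightarrow> Xv i \<noteq> {}"
    and conn: "\<And>i k. i \<in> V \<Longrightarrow> k \<in> V \<Longrightarrow> (i, k) \<in> {(i, k). i \<in> V \<and> k \<in> V \<and> Xv i \<inter> Xv k \<noteq> {}}\<^sup>*"
    and L: "\<And>f. f \<in> X \<Longrightarrow> bij_betw (L f) I J"
    and hit: "\<And>i \<beta> t. i \<in> V \<Longrightarrow> t \<in> J \<Longrightarrow> \<forall>f\<in>Xv i. L f (\<beta> f) = t \<Longrightarrow> P i \<beta> = R t i"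
    and miss: "\<And>i \<beta>. i \<in> V \<Longrightarrow> \<not> (\<exists>t\<in>J. \<forall>f\<in>Xv i. L f (\<beta> f) = t) \<Longrightarrow> P i \<beta> = 0"
  shows "(\<Sum>\<alpha> \<in> X \<rightarrow>\<^sub>E I. \<Prod>i\<in>V. P i (restrict \<alpha> (Xv i))) = (\<Sum>t\<in>J. \<Prod>i\<in>V. R t i)"
proof -
  \<comment> \<open>\<open>A t\<close> is the only assignment that shows the label \<open>t\<close>
    at every place.\<close>
  define A where "A t = restrict (\<lambda>f. inv_into I (L f) t) X" for t
  have LA: "L f (A t f) = t" if "f \<in> X" "t \<in> J" for f t
    using that bij_betw_inv_into_right[OF L[OF that(1)] that(2)] by (simp add: A_def)
  have A_in: "A t \<in> X \<rightarrow>\<^sub>E I" if "t \<in> J" for t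
    using that L unfolding A_def by (auto intro!: inv_into_into simp: bij_betw_def)
  \<comment> \<open>Reading the label at one fixed place \<open>f0\<close> recovers \<open>t\<close>
    from \<open>A t\<close>.\<close>
  from ne \<open>V \<noteq> {}\<close> X obtain f0 where f0: "f0 \<in> X" by blast
  have inj: "inj_on A J"
    by (rule inj_onI) (metis LA f0)
  have zero: "(\<Prod>i\<in>V. P i (restrict \<alpha> (Xv i))) = 0"
    if \<alpha>: "\<alpha> \<in> (X \<rightarrow>\<^sub>E I) - A ` J" for \<alpha>
  proof (rule ccontr)
    assume nz: "\<not> ?thesis"
    have "\<exists>t\<in>J. \<forall>f\<in>Xv i. L f (\<alpha> f) = t" if "i \<in> V" for i
    proof (rule ccontr)
      assume "\<not> (\<exists>t\<in>J. \<forall>f\<in>Xv i. L f (\<alpha> f) = t)"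
      then have "P i (restrict \<alpha> (Xv i)) = 0"
        using that by (intro miss) auto
      then have "(\<Prod>i\<in>V. P i (restrict \<alpha> (Xv i))) = 0"
        using that \<open>finite V\<close> by (intro prod_zero) auto
      then show False using nz by simp
    qed
    then have "\<forall>i\<in>V. \<exists>t. t \<in> J \<and> (\<forall>f\<in>Xv i. L f (\<alpha> f) = t)" by blast
    from bchoice[OF this] obtain T where T: "\<And>i. i \<in> V \<Longrightarrow> T i \<in> J"
      and TL: "\<And>i f. i \<in> V \<Longrightarrow> f \<in> Xv i \<Longrightarrow> L f (\<alpha> f) = T i"
      by blast
    \<comment> \<open>Consecutive vertices of a chain share a place, whose label is that of
      both.\<close>
    have T_const: "T i = T k" if "i \<in> V" "k \<in> V" for i k
      using conn[OF that]
    proof (induction rule: rtrancl_induct)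
      case (step k l)
      then obtain f where "k \<in> V" "l \<in> V" "f \<in> Xv k" "f \<in> Xv l" by auto
      then have "T k = T l" using TL by metis
      then show ?case using step by simp
    qed simp
    obtain i0 where i0: "i0 \<in> V" using \<open>V \<noteq> {}\<close> by blast
    have "\<alpha> = A (T i0)"
    proof (rule PiE_ext)
      show "\<alpha> \<in> X \<rightarrow>\<^sub>E I" using \<alpha> by blast
      show "A (T i0) \<in> X \<rightarrow>\<^sub>E I" using A_in T i0 by blast
      fix f assume f: "f \<in> X"
      then obtain i where "i \<in> V" "f \<in> Xv i" using X by blast
      then have "L f (\<alpha> f) = T i0" using TL T_const i0 by metis
      moreover have "L f (A (T i0) f) = T i0" using LA f T i0 by blast
      moreover have "\<alpha> f \<in> I" "A (T i0) f \<in> I"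
        using \<alpha> A_in[OF T[OF i0]] f by auto
      ultimately show "\<alpha> f = A (T i0) f"
        using L[OF f] by (metis bij_betw_def inj_onD)
    qed
    then show False using \<alpha> T i0 by blast
  qed
  have "(\<Sum>\<alpha> \<in> X \<rightarrow>\<^sub>E I. \<Prod>i\<in>V. P i (restrict \<alpha> (Xv i)))
      = (\<Sum>\<alpha> \<in> A ` J. \<Prod>i\<in>V. P i (restrict \<alpha> (Xv i)))"
    using A_in zero assms(3,4) by (intro sum.mono_neutral_right) (auto intro: finite_PiE)
  also have "\<dots> = (\<Sum>t\<in>J. \<Prod>i\<in>V. P i (restrict (A t) (Xv i)))"
    by (simp add: sum.reindex[OF inj])
  also have "\<dots> = (\<Sum>t\<in>J. \<Prod>i\<in>V. R t i)"
  proof (intro sum.cong prod.cong refl)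
    fix t i assume "t \<in> J" "i \<in> V"
    then show "P i (restrict (A t) (Xv i)) = R t i"
      using LA X by (intro hit) auto
  qed
  finally show ?thesis .
qed

section \<open>Free actions\<close>

text \<open>Fix a representative of each orbit and let \<open>z x\<close> carry it to
  \<open>x\<close>. Both \<open>z (\<phi> g x)\<close> and \<open>g \<otimes> z x\<close> carry the
  representative to \<open>\<phi> g x\<close>, and by freeness only one group element does
  so.\<close>

lemma (in group_action) free_imp_equivariant_map:
  assumes free: "\<And>x. x \<in> E \<Longrightarrow> stabilizer G \<phi> x = {\<one>}"
  obtains z where "\<And>x. x \<in> E \<Longrightarrow> z x \<in> carrier G"
    and "\<And>g x. g \<in> carrier G \<Longrightarrow> x \<in> E \<Longrightarrow> z (\<phi> g x) = g \<otimes> z x"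
proof -
  interpret group G using group_hom group_hom.axioms(1) by auto
  \<comment> \<open>The choice depends on \<open>x\<close> only through its orbit as a set, so all
    points of an orbit get the same representative.\<close>
  define rep where "rep x = (SOME y. y \<in> orbit G \<phi> x)" for x
  have orbit_E: "orbit G \<phi> x \<subseteq> E" if "x \<in> E" for x
    using that element_image by (auto simp: orbit_def)
  have rep: "rep x \<in> orbit G \<phi> x" if "x \<in> E" for x
    unfolding rep_def using orbit_refl[OF that] by (rule someI)
  have rep_E: "rep x \<in> E" if "x \<in> E" for x
    using rep orbit_E that by blast
  have rep_act: "rep (\<phi> g x) = rep x" if g: "g \<in> carrier G" and x: "x \<in> E" for g x
  proof -
    have gx: "\<phi> g x \<in> E" "\<phi> g x \<in> orbit G \<phi> x"
      using g x element_image by (auto simp: orbit_def)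
    then have "orbit G \<phi> (\<phi> g x) = orbit G \<phi> x"
      using orbit_trans orbit_sym orbit_E x by (meson subset_antisym subsetD subsetI)
    then show ?thesis by (simp add: rep_def)
  qed
  define z where "z x = (SOME g. g \<in> carrier G \<and> \<phi> g (rep x) = x)" for x
  have z: "z x \<in> carrier G \<and> \<phi> (z x) (rep x) = x" if "x \<in> E" for x
  proof -
    have "x \<in> orbit G \<phi> (rep x)"
      using orbit_sym rep rep_E that by blast
    then show ?thesis
      unfolding z_def by (intro someI_ex[where P = "\<lambda>g. g \<in> carrier G \<and> \<phi> g (rep x) = x"])
        (auto simp: orbit_def)
  qed
  have unique: "g = h" if "g \<in> carrier G" "h \<in> carrier G" "x \<in> E" "\<phi> g x = \<phi> h x" for g h x
  proof -
    have "\<phi> (inv h \<otimes> g) x = x"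
      using that by (simp add: composition_rule orbit_sym_aux[of h x])
    then have "inv h \<otimes> g \<in> stabilizer G \<phi> x"
      using that by (simp add: stabilizer_def)
    then have "inv h \<otimes> g = \<one>"
      using free that by blast
    then show ?thesis
      using that by (metis inv_equality inv_inv inv_closed)
  qed
  show ?thesis
  proof (rule that)
    show "z x \<in> carrier G" if "x \<in> E" for x using z that by blast
    show "z (\<phi> g x) = g \<otimes> z x" if g: "g \<in> carrier G" and x: "x \<in> E" for g x
    proof (rule unique)
      have gx: "\<phi> g x \<in> E" using element_image g x by blast
      show "z (\<phi> g x) \<in> carrier G" "g \<otimes> z x \<in> carrier G" "rep x \<in> E"
        using z gx g x rep_E by auto
      show "\<phi> (z (\<phi> g x)) (rep x) = \<phi> (g \<otimes> z x) (rep x)"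
        using z[OF gx] z[OF x] rep_act[OF g x] g rep_E[OF x] by (simp add: composition_rule)
    qed
  qed
qed

section \<open>Facets\<close>

lemma finite_facet_copies: "finite (facet_copies n \<Omega>)"
proof -
  have "finite (facets n \<Omega>)"
    by (rule finite_subset[of _ "Pow {0..n}"]) (auto simp: facets_def simplices_def)
  moreover have "facet_copies n \<Omega> = Sigma (facets n \<Omega>) (\<lambda>F. {..<\<Omega> F})"
    by (auto simp: facet_copies_def)
  ultimately show ?thesis by simp
qed

text \<open>A facet is a simplex, so its weight is nonzero and the copy numbered 0 exists.\<close>

lemma facet_copy_0:
  assumes "F \<in> facets n \<Omega>" "i \<in> F"
  shows "(F, 0) \<in> facet_copies_at n \<Omega> i"
  using assms by (simp add: facet_copies_at_def facet_copies_def facets_def simplices_def)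

lemma simplex_subset_facet:
  assumes "S \<in> simplices n \<Omega>"
  obtains F where "F \<in> facets n \<Omega>" "S \<subseteq> F"
proof -
  have "finite (simplices n \<Omega>)"
    by (rule finite_subset[of _ "Pow {0..n}"]) (auto simp: simplices_def)
  from finite_has_maximal2[OF this assms] obtain F
    where "F \<in> simplices n \<Omega>" "S \<subseteq> F" "\<forall>T \<in> simplices n \<Omega>. F \<subseteq> T \<longrightarrow> F = T" by blast
  then have "F \<in> facets n \<Omega>" by (auto simp: facets_def)
  then show ?thesis using \<open>S \<subseteq> F\<close> by (rule that)
qed

lemma vertex_in_facet:
  assumes "weighted_complex n \<Omega>" "i \<in> {0..n}"
  obtains F where "F \<in> facets n \<Omega>" "i \<in> F"
proof -
  have "{i} \<in> simplices n \<Omega>"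
    using assms by (auto simp: weighted_complex_def simplices_def)
  then show ?thesis by (rule simplex_subset_facet) (use that in auto)
qed

text \<open>The point is that no facet is empty: by maximality an empty facet would equal a facet
  through the vertex 0.\<close>

lemma facet_copies_eq_UN:
  assumes "weighted_complex n \<Omega>"
  shows "facet_copies n \<Omega> = (\<Union>i\<in>{0..n}. facet_copies_at n \<Omega> i)"
proof (intro equalityI subsetI)
  fix f assume f: "f \<in> facet_copies n \<Omega>"
  then have F: "fst f \<in> facets n \<Omega>" by (auto simp: facet_copies_def)
  obtain H where "H \<in> facets n \<Omega>" "0 \<in> H"
    using vertex_in_facet[OF assms, of 0] by auto
  with F have "fst f \<noteq> {}" by (auto simp: facets_def)
  then obtain i where "i \<in> fst f" by blast
  moreover then have "i \<in> {0..n}" using F by (auto simp: facets_def simplices_def)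
  ultimately show "f \<in> (\<Union>i\<in>{0..n}. facet_copies_at n \<Omega> i)"
    using f by (auto simp: facet_copies_at_def)
qed (auto simp: facet_copies_at_def)

text \<open>Neighbours lie in a common facet, and its copy numbered 0 is a facet copy at both of
  them.\<close>

lemma connected_by_facet_copies:
  assumes "connected_complex n \<Omega>" "i \<in> {0..n}" "k \<in> {0..n}"
  shows "(i, k) \<in> {(i, k). i \<in> {0..n} \<and> k \<in> {0..n} \<and>
    facet_copies_at n \<Omega> i \<inter> facet_copies_at n \<Omega> k \<noteq> {}}\<^sup>*"
proof -
  have "neighbours n \<Omega> \<subseteq> {(i, k). i \<in> {0..n} \<and> k \<in> {0..n} \<and>
    facet_copies_at n \<Omega> i \<inter> facet_copies_at n \<Omega> k \<noteq> {}}"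
  proof (clarify, goal_cases)
    case (1 i k)
    then obtain F where F: "F \<in> facets n \<Omega>" "i \<in> F" "k \<in> F"
      by (auto simp: neighbours_def)
    moreover from F have "i \<in> {0..n}" "k \<in> {0..n}"
      by (auto simp: facets_def simplices_def)
    ultimately show ?case using facet_copy_0 by blast
  qed
  then show ?thesis
    using assms rtrancl_mono unfolding connected_complex_def by blast
qed

text \<open>The collapse map is equivariant and \<open>\<phi> g\<close> is injective on the
  vertices, so \<open>g i\<close> lies in the translated facet only if \<open>i\<close> lies in the
  original one.\<close>

lemma facet_copies_at_act:
  assumes "complex_action n \<Omega> G \<phi> \<psi>" "g \<in> carrier G" "i \<in> {0..n}" "f \<in> facet_copies n \<Omega>"
  shows "\<psi> g f \<in> facet_copies_at n \<Omega> (\<phi> g i) \<longleftrightarrow> f \<in> facet_copies_at n \<Omega> i"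
proof -
  interpret V: group_action G "{0..n}" \<phi>
    using assms by (simp add: complex_action_def)
  interpret E: group_action G "facet_copies n \<Omega>" \<psi>
    using assms by (simp add: complex_action_def)
  have "fst f \<subseteq> {0..n}"
    using assms(4) by (auto simp: facet_copies_def facets_def simplices_def)
  then have "\<phi> g i \<in> \<phi> g ` fst f \<longleftrightarrow> i \<in> fst f"
    by (rule inj_on_image_mem_iff[OF V.inj_prop[OF assms(2)] assms(3)])
  moreover have "\<psi> g f \<in> facet_copies n \<Omega>"
    using E.element_image assms by blast
  moreover have "fst (\<psi> g f) = \<phi> g ` fst f"
    using assms by (simp add: complex_action_def)
  ultimately show ?thesis using assms(4) by (simp add: facet_copies_at_def)
qed

section \<open>The decomposition\<close>

text \<open>The factor at \<open>i\<close> of the translate by \<open>h\<close> originates at the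
  vertex \<open>inv h\<close> applied to \<open>i\<close>. Reindexing by \<open>\<phi> h\<close>
  puts the factor \<open>q j i\<close> into block \<open>\<phi> h i\<close>, which is its image
  under \<open>h\<close>.\<close>

lemma sum_prod_translates:
  assumes act: "group_action G {0..n} \<phi>" and h: "h \<in> carrier G"
    and loc: "\<And>j i. j < r \<Longrightarrow> i \<in> {0..n} \<Longrightarrow> q j i \<in> local_ring m i"
  shows "(\<Sum>j<r. \<Prod>i\<in>{0..n}. block_subst (\<phi> (inv\<^bsub>G\<^esub> h) i) i (q j (\<phi> (inv\<^bsub>G\<^esub> h) i)))
    = poly_act \<phi> h (\<Sum>j<r. \<Prod>i\<in>{0..n}. q j i)"
proof -
  interpret V: group_action G "{0..n}" \<phi> by (rule act)
  have "(\<Prod>i\<in>{0..n}. block_subst (\<phi> (inv\<^bsub>G\<^esub> h) i) i (q j (\<phi> (inv\<^bsub>G\<^esub> h) i)))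
      = (\<Prod>i\<in>{0..n}. poly_act \<phi> h (q j i))" if j: "j < r" for j
  proof -
    have "bij_betw (\<phi> h) {0..n} {0..n}"
      using V.bij_prop0[OF h] by (simp add: Bij_def)
    then have "(\<Prod>i\<in>{0..n}. block_subst (\<phi> (inv\<^bsub>G\<^esub> h) i) i (q j (\<phi> (inv\<^bsub>G\<^esub> h) i)))
      = (\<Prod>i\<in>{0..n}. block_subst (\<phi> (inv\<^bsub>G\<^esub> h) (\<phi> h i)) (\<phi> h i) (q j (\<phi> (inv\<^bsub>G\<^esub> h) (\<phi> h i))))"
      by (rule prod.reindex_bij_betw[symmetric])
    also have "\<dots> = (\<Prod>i\<in>{0..n}. poly_act \<phi> h (q j i))"
    proof (rule prod.cong)
      fix i assume i: "i \<in> {0..n}"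
      have "\<phi> (inv\<^bsub>G\<^esub> h) (\<phi> h i) = i"
        using V.orbit_sym_aux[OF h i refl] .
      then show "block_subst (\<phi> (inv\<^bsub>G\<^esub> h) (\<phi> h i)) (\<phi> h i) (q j (\<phi> (inv\<^bsub>G\<^esub> h) (\<phi> h i)))
        = poly_act \<phi> h (q j i)"
        by (simp add: poly_act_local[OF loc[OF j i]])
    qed simp
    finally show ?thesis .
  qed
  then show ?thesis
    by (simp add: poly_act_def psubst_sum psubst_prod)
qed

theorem theorem24:
  fixes n :: nat
    and \<Omega> :: "nat set \<Rightarrow> nat"
    and G :: "('g, 'b) monoid_scheme"
    and \<phi> :: "'g \<Rightarrow> nat \<Rightarrow> nat"
    and \<psi> :: "'g \<Rightarrow> nat set \<times> nat \<Rightarrow> nat set \<times> nat"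
    and m :: "nat \<Rightarrow> nat"
    and C :: "nat \<Rightarrow> rpoly set"
    and p :: rpoly
  assumes "weighted_complex n \<Omega>"
    and "connected_complex n \<Omega>"
    and "group G"
    and "finite (carrier G)"
    and "free_complex_action n \<Omega> G \<phi> \<psi>"
    and "\<forall>i\<in>{0..n}. \<forall>g \<in> carrier G. m (\<phi> g i) = m i"
    and "\<forall>i\<in>{0..n}. C i \<subseteq> local_ring m i \<and> convex_poly_cone (C i)"
    and "\<forall>i\<in>{0..n}. \<forall>g \<in> carrier G. C (\<phi> g i) = block_subst i (\<phi> g i) ` C i"
    and "p \<in> sep_cone n C"
    and "poly_invariant G \<phi> p"
  shows "admits_separable_decomposition n \<Omega> G \<phi> \<psi> C p"
proof -
  interpret group G by fact
  have cact: "complex_action n \<Omega> G \<phi> \<psi>"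
    using assms(5) by (simp add: free_complex_action_def)
  then interpret V: group_action G "{0..n}" \<phi>
    by (simp add: complex_action_def)
  interpret E: group_action G "facet_copies n \<Omega>" \<psi>
    using cact by (simp add: complex_action_def)
  let ?X = "facet_copies n \<Omega>" and ?Xv = "facet_copies_at n \<Omega>"
  have XvX: "?Xv i \<subseteq> ?X" for i by (auto simp: facet_copies_at_def)
  obtain z where z: "\<And>f. f \<in> ?X \<Longrightarrow> z f \<in> carrier G"
    and z_act: "\<And>g f. g \<in> carrier G \<Longrightarrow> f \<in> ?X \<Longrightarrow> z (\<psi> g f) = g \<otimes>\<^bsub>G\<^esub> z f"
    using E.free_imp_equivariant_map assms(5) unfolding free_complex_action_def by metis
  obtain r :: nat and q where p: "p = (\<Sum>j<r. \<Prod>i\<in>{0..n}. q j i)"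
    and q: "\<And>j i. j < r \<Longrightarrow> i \<in> {0..n} \<Longrightarrow> q j i \<in> C i"
    using assms(9) unfolding sep_cone_def by blast
  have q_loc: "q j i \<in> local_ring m i" if "j < r" "i \<in> {0..n}" for j i
    using q assms(7) that by blast
  \<comment> \<open>\<open>J\<close> consists of the labels. Indices have to be natural numbers, so
    \<open>I\<close> enumerates \<open>J\<close> and \<open>b\<close> decodes an index into a pair
    \<open>(j, a)\<close>.\<close>
  define J where "J = {..<r} \<times> carrier G"
  define I where "I = {0..<card J}"
  have "finite J" using assms(4) by (simp add: J_def)
  then obtain b where b: "bij_betw b I J"
    unfolding I_def using ex_bij_betw_nat_finite by blast
  define tr where "tr g t = (fst t, g \<otimes>\<^bsub>G\<^esub> snd t)" for g and t :: "nat \<times> 'g"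
  have tr_bij: "bij_betw (tr g) J J" if "g \<in> carrier G" for g
    using that by (intro bij_betw_byWitness[where f' = "tr (inv\<^bsub>G\<^esub> g)"])
      (auto simp: tr_def J_def m_assoc[symmetric])
  \<comment> \<open>For \<open>a \<in> I\<close> and \<open>f\<close> a facet copy, equivariance of
    \<open>z\<close> gives \<open>L (\<psi> g f) a = tr g (L f a)\<close>: the same index, carried
    along by \<open>g\<close>, shows the label translated by \<open>g\<close>.\<close>
  define L where "L f a = tr (z f) (b a)" for f a
  have L: "bij_betw (L f) I J" if "f \<in> ?X" for f
    using bij_betw_trans[OF b tr_bij[OF z[OF that]]] by (simp add: L_def[abs_def] comp_def)
  define N where "N = real (card (carrier G))"
  have N: "N > 0"
    using assms(4) by (auto simp: N_def card_gt_0_iff)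
  \<comment> \<open>The factor \<open>1 / N\<close> of the average has to be spread evenly over the \<open>n + 1\<close> vertices,
    lest it break equivariance.\<close>
  define c where "c = root (Suc n) (1 / N)"
  have c: "c \<ge> 0" "c ^ Suc n = 1 / N"
    using N by (simp_all add: c_def del: power_Suc)
  \<comment> \<open>For \<open>t = (j, h)\<close> this is the factor at \<open>i\<close> of the
    translate of the \<open>j\<close>-th product by \<open>h\<close>, scaled by
    \<open>c\<close>.\<close>
  define R where "R t i = pconst c * block_subst (\<phi> (inv\<^bsub>G\<^esub> (snd t)) i) i (q (fst t) (\<phi> (inv\<^bsub>G\<^esub> (snd t)) i))"
    for t i
  \<comment> \<open>Some facet copy contains \<open>i\<close>, so a common label is unique and the
    description is well defined.\<close>
  define P where "P i \<beta> = (if \<exists>t\<in>J. \<forall>f\<in>?Xv i. L f (\<beta> f) = t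
      then R (THE t. \<forall>f\<in>?Xv i. L f (\<beta> f) = t) i else 0)" for i \<beta>
  have ne: "?Xv i \<noteq> {}" if "i \<in> {0..n}" for i
    using vertex_in_facet[OF assms(1) that] facet_copy_0 by (metis empty_iff)
  have hit: "P i \<beta> = R t i" if "i \<in> {0..n}" "t \<in> J" "\<forall>f\<in>?Xv i. L f (\<beta> f) = t" for i \<beta> t
  proof -
    have "?Xv i \<noteq> {}" using ne that by blast
    then have "(THE t. \<forall>f\<in>?Xv i. L f (\<beta> f) = t) = t"
      using that(3) by (intro the_equality) auto
    then show ?thesis using that by (auto simp: P_def)
  qed
  have miss: "P i \<beta> = 0" if "\<not> (\<exists>t\<in>J. \<forall>f\<in>?Xv i. L f (\<beta> f) = t)" for i \<beta>
    unfolding P_def using that by (rule if_not_P)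
  \<comment> \<open>The compatibility of the cones is applied at the vertex \<open>?k\<close>, which
    \<open>?h\<close> carries to \<open>i\<close>.\<close>
  have R_cone: "R t i \<in> C i" if "i \<in> {0..n}" "t \<in> J" for t i
  proof -
    let ?h = "snd t" and ?k = "\<phi> (inv\<^bsub>G\<^esub> (snd t)) i"
    have h: "?h \<in> carrier G" "fst t < r" using that by (auto simp: J_def)
    have k: "?k \<in> {0..n}" using V.element_image that h by blast
    have hk: "\<phi> ?h ?k = i"
      using V.orbit_sym_aux[of "inv\<^bsub>G\<^esub> ?h" i] that h by simp
    have "block_subst ?k (\<phi> ?h ?k) (q (fst t) ?k) \<in> C (\<phi> ?h ?k)"
      using assms(8) k h q by blast
    then show ?thesis
      unfolding R_def hk using convex_poly_cone_scale assms(7) that c by blast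
  qed
  \<comment> \<open>Since \<open>inv (g \<otimes> h)\<close> sends \<open>g i\<close> to
    \<open>inv h\<close> applied to \<open>i\<close>, both sides stem from the same factor of the
    same product; they differ only by a detour through block \<open>g i\<close>.\<close>
  have R_tr: "block_subst (\<phi> g i) i (R (tr g t) (\<phi> g i)) = R t i"
    if "i \<in> {0..n}" "t \<in> J" "g \<in> carrier G" for t i g
  proof -
    have t: "snd t \<in> carrier G" "fst t < r" using that by (auto simp: J_def)
    have gi: "\<phi> g i \<in> {0..n}" using V.element_image that by blast
    have k: "\<phi> (inv\<^bsub>G\<^esub> (snd t)) i \<in> {0..n}" using V.element_image that t by blast
    have "\<phi> (inv\<^bsub>G\<^esub> (g \<otimes>\<^bsub>G\<^esub> snd t)) (\<phi> g i) = \<phi> (inv\<^bsub>G\<^esub> (snd t)) (\<phi> (inv\<^bsub>G\<^esub> g) (\<phi> g i))"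
      using that t gi by (simp add: inv_mult_group V.composition_rule)
    also have "\<phi> (inv\<^bsub>G\<^esub> g) (\<phi> g i) = i"
      using V.orbit_sym_aux that by blast
    finally show ?thesis
      using block_subst_block_subst[OF q_loc[OF t(2) k]]
      by (simp add: R_def tr_def block_subst_pconst_mult)
  qed
  \<comment> \<open>The translated index function has at \<open>\<psi> g f\<close> the value
    \<open>\<beta> f\<close>, hence shows there the label of \<open>f\<close> translated by
    \<open>g\<close>; and \<open>tr g\<close> is injective on \<open>J\<close>.\<close>
  have label_act: "(\<forall>f\<in>?Xv (\<phi> g i). L f (index_act n \<Omega> G \<phi> \<psi> i g \<beta> f) = tr g t)
      \<longleftrightarrow> (\<forall>f\<in>?Xv i. L f (\<beta> f) = t)"
    if i: "i \<in> {0..n}" and g: "g \<in> carrier G" and t: "t \<in> J" and \<beta>: "\<beta> \<in> ?Xv i \<rightarrow>\<^sub>E I" for i g t \<beta>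
  proof -
    have im: "?Xv (\<phi> g i) = \<psi> g ` ?Xv i"
    proof (intro equalityI subsetI)
      fix f assume f: "f \<in> ?Xv (\<phi> g i)"
      with XvX obtain f' where "f' \<in> ?X" "f = \<psi> g f'"
        using E.surj_prop[OF g] by (metis imageE subsetD)
      then show "f \<in> \<psi> g ` ?Xv i"
        using f facet_copies_at_act[OF cact g i] by blast
    qed (use XvX facet_copies_at_act[OF cact g i] in blast)
    have "L (\<psi> g f) (index_act n \<Omega> G \<phi> \<psi> i g \<beta> (\<psi> g f)) = tr g (L f (\<beta> f))"
      if f: "f \<in> ?Xv i" for f
    proof -
      have fX: "f \<in> ?X" using f XvX by blast
      have "b (\<beta> f) \<in> J"
        using bij_betwE[OF b] PiE_mem[OF \<beta> f] by blast
      then have "snd (b (\<beta> f)) \<in> carrier G" by (auto simp: J_def)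
      moreover have "index_act n \<Omega> G \<phi> \<psi> i g \<beta> (\<psi> g f) = \<beta> f"
        using im f E.orbit_sym_aux[OF g fX refl] by (simp add: index_act_def)
      ultimately show ?thesis
        using z z_act g fX by (simp add: L_def tr_def m_assoc)
    qed
    moreover have "tr g (L f (\<beta> f)) = tr g t \<longleftrightarrow> L f (\<beta> f) = t" if f: "f \<in> ?Xv i" for f
    proof -
      have "L f (\<beta> f) \<in> J"
        using bij_betwE[OF L] XvX PiE_mem[OF \<beta> f] f by blast
      then show ?thesis
        using tr_bij[OF g] t by (metis bij_betw_def inj_onD)
    qed
    ultimately show ?thesis unfolding im by simp
  qed
  have "separable_decomposition n \<Omega> G \<phi> \<psi> C p I P"
    unfolding separable_decomposition_def
  proof (intro conjI ballI)
    show "finite I" by (simp add: I_def)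
    show "P i \<beta> \<in> C i" if "i \<in> {0..n}" for i \<beta>
      using hit miss R_cone that convex_poly_cone_0 assms(7) by metis
    have "(\<Sum>\<alpha> \<in> ?X \<rightarrow>\<^sub>E I. \<Prod>i\<in>{0..n}. P i (restrict \<alpha> (?Xv i))) = (\<Sum>t\<in>J. \<Prod>i\<in>{0..n}. R t i)"
      by (rule sum_PiE_constant_labels[OF _ _ finite_facet_copies _ facet_copies_eq_UN[OF assms(1)]
            ne connected_by_facet_copies[OF assms(2)] L hit miss]) (simp_all add: I_def)
    \<comment> \<open>Grouping labels by \<open>h\<close> collects the whole translate of
      \<open>p\<close> by \<open>h\<close>; the \<open>n + 1\<close> factors \<open>c\<close>
      multiply to \<open>1 / N\<close>, and invariance makes the \<open>N\<close> summands
      equal.\<close>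
    also have "\<dots> = (\<Sum>h\<in>carrier G. \<Sum>j<r. \<Prod>i\<in>{0..n}. R (j, h) i)"
      unfolding J_def by (subst sum.swap) (simp add: sum.cartesian_product)
    also have "\<dots> = (\<Sum>h\<in>carrier G. pconst (1 / N) * p)"
    proof (rule sum.cong)
      fix h assume h: "h \<in> carrier G"
      have "(\<Sum>j<r. \<Prod>i\<in>{0..n}. R (j, h) i) = pconst (c ^ Suc n) *
        (\<Sum>j<r. \<Prod>i\<in>{0..n}. block_subst (\<phi> (inv\<^bsub>G\<^esub> h) i) i (q j (\<phi> (inv\<^bsub>G\<^esub> h) i)))"
        by (simp add: R_def prod.distrib sum_distrib_left pconst_power del: power_Suc)
      also have "\<dots> = pconst (1 / N) * poly_act \<phi> h p"
        unfolding c(2) p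
        by (subst sum_prod_translates[OF V.group_action_axioms h, of r q m]) (simp_all add: q_loc)
      also have "poly_act \<phi> h p = p"
        using assms(10) h by (simp add: poly_invariant_def)
      finally show "(\<Sum>j<r. \<Prod>i\<in>{0..n}. R (j, h) i) = pconst (1 / N) * p" .
    qed simp
    also have "\<dots> = pconst (N * (1 / N)) * p"
      by (simp add: pconst_mult N_def pconst_of_nat mult.assoc del: times_divide_eq_right)
    also have "\<dots> = p" using N by simp
    finally show "p = (\<Sum>\<alpha> \<in> ?X \<rightarrow>\<^sub>E I. \<Prod>i\<in>{0..n}. P i (restrict \<alpha> (?Xv i)))" ..
    show "P i \<beta> = block_subst (\<phi> g i) i (P (\<phi> g i) (index_act n \<Omega> G \<phi> \<psi> i g \<beta>))"
      if i: "i \<in> {0..n}" and g: "g \<in> carrier G" and \<beta>: "\<beta> \<in> ?Xv i \<rightarrow>\<^sub>E I" for i g \<beta>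
    proof (cases "\<exists>t\<in>J. \<forall>f\<in>?Xv i. L f (\<beta> f) = t")
      case True
      then obtain t where t: "t \<in> J" "\<forall>f\<in>?Xv i. L f (\<beta> f) = t" by blast
      have gi: "\<phi> g i \<in> {0..n}" using V.element_image i g by blast
      have "tr g t \<in> J" using bij_betwE[OF tr_bij[OF g]] t by blast
      then have "P (\<phi> g i) (index_act n \<Omega> G \<phi> \<psi> i g \<beta>) = R (tr g t) (\<phi> g i)"
        using t label_act[OF i g t(1) \<beta>] gi by (intro hit) auto
      then show ?thesis
        using R_tr[OF i t(1) g] hit[OF i t] by simp
    next
      case False
      \<comment> \<open>A common label at \<open>g i\<close> would be \<open>tr g t\<close> for some
        \<open>t \<in> J\<close>, and \<open>t\<close> would be common at \<open>i\<close>. Hence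
        both sides of the equivariance equation are 0.\<close>
      have "\<not> (\<exists>s\<in>J. \<forall>f\<in>?Xv (\<phi> g i). L f (index_act n \<Omega> G \<phi> \<psi> i g \<beta> f) = s)"
      proof
        assume "\<exists>s\<in>J. \<forall>f\<in>?Xv (\<phi> g i). L f (index_act n \<Omega> G \<phi> \<psi> i g \<beta> f) = s"
        then obtain s where s: "s \<in> J" "\<forall>f\<in>?Xv (\<phi> g i). L f (index_act n \<Omega> G \<phi> \<psi> i g \<beta> f) = s"
          by blast
        obtain t where t: "t \<in> J" "s = tr g t"
          using s(1) bij_betw_imp_surj_on[OF tr_bij[OF g]] by (metis imageE)
        have "\<forall>f\<in>?Xv i. L f (\<beta> f) = t"
          using s(2) label_act[OF i g t(1) \<beta>] by (simp only: t(2))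
        then show False using False t(1) by blast
      qed
      then show ?thesis
        using miss False by (simp add: block_subst_def)
    qed
  qed
  then show ?thesis
    unfolding admits_separable_decomposition_def by blast
qed

end
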